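(* Let $k$ be an algebraically closed field of characteristic zero, let $B$ be a finitely generated $k$-domain, and let $D$ be a semisimple $k$-derivation of $B$ whose eigenvalues are all integers. Assume that there exists a nonzero element $s\in B$ such that $D(s)=s$. Let $B=k[b_1,\dots,b_n]$ with $D(b_i)=\lambda_i b_i$, $\lambda_i\in\mathbb{Z}$, for $i=1,\dots,n$, and set $B_s:=B[s^{-1}]$. Then the kernel $\ker(D)$ of $D$ on $B$ satisfies $$\ker(D)=\ker(D|_{B_s})\cap B=k\left[b_1s^{-\lambda_1},\dots,b_ns^{-\lambda_n}\right]\cap B.$$
   Context: A $k$-derivation $D$ of $B$ is called semisimple if $B$ is the direct sum of the eigenspaces of $D$, i.e. $B=\bigoplus_{\lambda\in k}B_\lambda$ with $B_\lambda=\{b\in B\mid D(b)=\lambda b\}$; its eigenvalues are the $\lambda\in k$ with $B_\lambda\neq 0$. Since $k$ has characteristic zero, $\mathbb{Z}$ is regarded as a subset of $k$. $B=k[b_1,\dots,b_n]$ means that $b_1,\dots,b_n$ generate $B$ as a $k$-algebra (they are not assumed algebraically independent). $D|_{B_s}$ is the unique extension of $D$ to a derivation of the localization $B_s$ (quotient rule), and $k[u_1,\dots,u_n]$ denotes the $k$-subalgebra of $B_s$ generated by $u_1,\dots,u_n$. Since $B$ is a domain, $B$ is viewed as a subring of $B_s$, and intersections are taken in $B_s$. *)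

theory Defs
  imports "HOL-Computational_Algebra.Computational_Algebra"
begin

text \<open>
  A commutative algebra over a field is a type of class \<open>comm_ring_1\<close> together with its structure
  map \<open>\<iota>\<close> from the field; \<open>\<iota> c * x\<close> is the scalar multiple of \<open>x\<close> by \<open>c\<close>.
  The fraction field of a domain with structure map \<open>\<iota>\<close> has structure map \<open>to_fract \<circ> \<iota>\<close>.
\<close>

locale k_algebra =
  fixes \<iota> :: "'k :: field \<Rightarrow> 'b :: comm_ring_1"
  assumes map_one: "\<iota> 1 = 1"
    and map_add: "\<iota> (c + d) = \<iota> c + \<iota> d"
    and map_mult: "\<iota> (c * d) = \<iota> c * \<iota> d"

definition subalgebra :: "('k :: field \<Rightarrow> 'b :: comm_ring_1) \<Rightarrow> 'b set \<Rightarrow> bool" where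
  "subalgebra \<iota> A \<longleftrightarrow> range \<iota> \<subseteq> A \<and> (\<forall>x\<in>A. \<forall>y\<in>A. x + y \<in> A \<and> x * y \<in> A)"

definition k_adjoin :: "('k :: field \<Rightarrow> 'b :: comm_ring_1) \<Rightarrow> 'b set \<Rightarrow> 'b set" where
  "k_adjoin \<iota> S = subalgebra \<iota> hull S"

text \<open>\<open>A\<close> is the carrier, so that derivations of a subalgebra of a larger ring are covered.\<close>

definition derivation_on ::
    "('k :: field \<Rightarrow> 'b :: comm_ring_1) \<Rightarrow> 'b set \<Rightarrow> ('b \<Rightarrow> 'b) \<Rightarrow> bool" where
  "derivation_on \<iota> A D \<longleftrightarrow>
     (\<forall>x\<in>A. D x \<in> A) \<and>
     (\<forall>x\<in>A. \<forall>y\<in>A. D (x + y) = D x + D y) \<and>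
     (\<forall>c. \<forall>x\<in>A. D (\<iota> c * x) = \<iota> c * D x) \<and>
     (\<forall>x\<in>A. \<forall>y\<in>A. D (x * y) = D x * y + x * D y)"

definition ker_on :: "'b set \<Rightarrow> ('b \<Rightarrow> 'b :: zero) \<Rightarrow> 'b set" where
  "ker_on A D = {x \<in> A. D x = 0}"

definition eigenspace ::
    "('k :: field \<Rightarrow> 'b :: comm_ring_1) \<Rightarrow> ('b \<Rightarrow> 'b) \<Rightarrow> 'k \<Rightarrow> 'b set" where
  "eigenspace \<iota> D l = {b. D b = \<iota> l * b}"

definition eigenvalue ::
    "('k :: field \<Rightarrow> 'b :: comm_ring_1) \<Rightarrow> ('b \<Rightarrow> 'b) \<Rightarrow> 'k \<Rightarrow> bool" where
  "eigenvalue \<iota> D l \<longleftrightarrow> eigenspace \<iota> D l \<noteq> {0}"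

text \<open>The direct sum condition: every element is a finite sum of components \<open>c l\<close> in the
  eigenspaces, for exactly one family \<open>c\<close>.\<close>

definition semisimple ::
    "('k :: field \<Rightarrow> 'b :: comm_ring_1) \<Rightarrow> ('b \<Rightarrow> 'b) \<Rightarrow> bool" where
  "semisimple \<iota> D \<longleftrightarrow>
     (\<forall>b. \<exists>!c. (\<forall>l. c l \<in> eigenspace \<iota> D l) \<and> finite {l. c l \<noteq> 0} \<and>
                b = (\<Sum>l | c l \<noteq> 0. c l))"

text \<open>For a domain \<open>B\<close> and \<open>s \<noteq> 0\<close>, the localization \<open>B[s\<^sup>-\<^sup>1]\<close> is taken inside the
  fraction field; \<open>range to_fract\<close> is the copy of \<open>B\<close> in it.\<close>

definition localization :: "'b :: idom \<Rightarrow> 'b fract set" where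
  "localization s = {Fract b (s ^ n) | b n. True}"

text \<open>The quotient rule. The value does not depend on the representation of \<open>x\<close> if \<open>D\<close> is a
  derivation and \<open>s \<noteq> 0\<close>; outside of \<open>localization s\<close> it is meaningless. The lemmas below show
  that this is the unique derivation of the localization extending \<open>D\<close>.\<close>

definition loc_derivation :: "'b :: idom \<Rightarrow> ('b \<Rightarrow> 'b) \<Rightarrow> 'b fract \<Rightarrow> 'b fract" where
  "loc_derivation s D x =
     (THE y. \<exists>b n. x = Fract b (s ^ n) \<and>
                   y = Fract (D b * s ^ n - b * D (s ^ n)) (s ^ n * s ^ n))"

lemma quotient_rule_well_defined:
  fixes a b p q :: "'b :: idom"
  assumes "derivation_on \<iota> UNIV D" and [simp]: "p \<noteq> 0" "q \<noteq> 0"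
    and eq: "Fract a p = Fract b q"
  shows "Fract (D a * p - a * D p) (p * p) = Fract (D b * q - b * D q) (q * q)"
proof -
  from eq have e: "a * q = b * p"
    by (simp add: eq_fract)
  then have "D (a * q) = D (b * p)"
    by simp
  with assms(1) have d: "D a * q + a * D q = D b * p + b * D p"
    by (simp add: derivation_on_def)
  have "(D a * p - a * D p) * (q * q) - (D b * q - b * D q) * (p * p)
      = p * q * ((D a * q + a * D q) - (D b * p + b * D p))
        + (a * q - b * p) * (- (p * D q) - q * D p)"
    by (simp add: algebra_simps)
  also have "\<dots> = 0"
    using d e by simp
  finally show ?thesis
    by (simp add: eq_fract)
qed

lemma loc_derivation_Fract:
  assumes "derivation_on \<iota> UNIV D" "s \<noteq> 0"
  shows "loc_derivation s D (Fract b (s ^ n)) =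
           Fract (D b * s ^ n - b * D (s ^ n)) (s ^ n * s ^ n)"
  unfolding loc_derivation_def
proof (rule the_equality)
  fix y
  assume "\<exists>b' n'. Fract b (s ^ n) = Fract b' (s ^ n') \<and>
            y = Fract (D b' * s ^ n' - b' * D (s ^ n')) (s ^ n' * s ^ n')"
  then show "y = Fract (D b * s ^ n - b * D (s ^ n)) (s ^ n * s ^ n)"
    using quotient_rule_well_defined[OF assms(1)] assms(2) by (metis power_not_zero)
qed blast

lemma derivation_on_one:
  assumes "derivation_on \<iota> A D" "1 \<in> A"
  shows "D 1 = 0"
proof -
  have "D (1 * 1) = D 1 * 1 + 1 * D 1"
    using assms unfolding derivation_on_def by blast
  then show ?thesis
    by simp
qed

lemma loc_derivation_to_fract:
  assumes "derivation_on \<iota> UNIV D" "s \<noteq> 0"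
  shows "loc_derivation s D (to_fract b) = to_fract (D b)"
  using loc_derivation_Fract[OF assms, of b 0] derivation_on_one[OF assms(1)]
  by (simp add: to_fract_def)

lemma derivation_on_loc_derivation:
  fixes s :: "'b :: idom"
  assumes D: "derivation_on \<iota> UNIV D" and s [simp]: "s \<noteq> 0"
  shows "derivation_on (to_fract \<circ> \<iota>) (localization s) (loc_derivation s D)"
proof -
  let ?E = "loc_derivation s D"
  have D_add: "D (x + y) = D x + D y" and D_mult: "D (x * y) = D x * y + x * D y"
    and D_scale: "D (\<iota> c * x) = \<iota> c * D x" for x y c
    using D by (auto simp: derivation_on_def)
  note E = loc_derivation_Fract[OF D s]
  have sum: "Fract a (s ^ m) + Fract b (s ^ n) = Fract (a * s ^ n + b * s ^ m) (s ^ (m + n))"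
    and prd: "Fract a (s ^ m) * Fract b (s ^ n) = Fract (a * b) (s ^ (m + n))" for a b m n
    by (simp_all add: power_add)
  have closed: "?E x \<in> localization s" if "x \<in> localization s" for x
  proof -
    from that obtain b n where "x = Fract b (s ^ n)"
      by (auto simp: localization_def)
    then have "?E x = Fract (D b * s ^ n - b * D (s ^ n)) (s ^ (n + n))"
      by (simp add: E power_add)
    then show ?thesis
      by (auto simp: localization_def)
  qed
  have add: "?E (x + y) = ?E x + ?E y" and mult: "?E (x * y) = ?E x * y + x * ?E y"
    if "x \<in> localization s" "y \<in> localization s" for x y
  proof -
    from that obtain a m b n where x: "x = Fract a (s ^ m)" and y: "y = Fract b (s ^ n)"
      by (auto simp: localization_def)
    show "?E (x + y) = ?E x + ?E y"
      unfolding x y sum E by (simp add: eq_fract power_add D_add D_mult algebra_simps)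
    show "?E (x * y) = ?E x * y + x * ?E y"
      unfolding x y prd E by (simp add: eq_fract power_add D_mult algebra_simps)
  qed
  have scale: "?E (to_fract (\<iota> c) * x) = to_fract (\<iota> c) * ?E x" if "x \<in> localization s" for c x
  proof -
    from that obtain b n where x: "x = Fract b (s ^ n)"
      by (auto simp: localization_def)
    have "to_fract (\<iota> c) * x = Fract (\<iota> c * b) (s ^ n)"
      by (simp add: x to_fract_def)
    then show ?thesis
      unfolding x by (simp add: E D_scale to_fract_def right_diff_distrib mult.assoc)
  qed
  show ?thesis
    unfolding derivation_on_def using closed add mult scale by simp
qed

lemma loc_derivation_unique:
  fixes s :: "'b :: idom"
  assumes D: "derivation_on \<iota> UNIV D" and s [simp]: "s \<noteq> 0"
    and E: "derivation_on (to_fract \<circ> \<iota>) (localization s) E"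
    and ext: "\<And>b. E (to_fract b) = to_fract (D b)"
    and x: "x \<in> localization s"
  shows "E x = loc_derivation s D x"
proof -
  from x obtain b n where b: "x = Fract b (s ^ n)"
    by (auto simp: localization_def)
  define p where "p = s ^ n"
  have p [simp]: "p \<noteq> 0"
    by (simp add: p_def)
  have emb: "to_fract a \<in> localization s" for a
    by (force simp: localization_def to_fract_def intro: exI[of _ a] exI[of _ 0])
  have xp: "x * to_fract p = to_fract b"
    by (simp add: b p_def to_fract_def eq_fract)
  have "E (x * to_fract p) = E x * to_fract p + x * E (to_fract p)"
    using E x emb unfolding derivation_on_def by blast
  then have "to_fract (D b) = E x * to_fract p + x * to_fract (D p)"
    by (simp only: xp ext)
  then have "E x = (to_fract (D b) - x * to_fract (D p)) / to_fract p"
    by (simp add: field_simps)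
  also have "\<dots> = Fract (D b * p - b * D p) (p * p)"
    by (simp add: b p_def to_fract_def)
  also have "\<dots> = loc_derivation s D x"
    unfolding b p_def by (rule loc_derivation_Fract[OF D s, symmetric])
  finally show ?thesis .
qed

end

theory Submission
  imports Defs
begin

text \<open>
  Multiplying \<open>b\<^sub>i\<close> by \<open>s\<^bsup>-\<lambda>\<^sub>i\<^esup>\<close> makes it a constant, so \<open>k[u\<^sub>1,\<dots>,u\<^sub>n]\<close> lies in the kernel of the
  extended derivation. Conversely, a monomial in the \<open>b\<^sub>i\<close> of weight \<open>m\<close> is \<open>s\<^sup>m\<close> times a monomial
  in the \<open>u\<^sub>i\<close>. Every \<open>x \<in> B\<close> is a sum of such monomials, and by uniqueness of the eigenspace
  decomposition a constant \<open>x\<close> is the sum of those of weight \<open>0\<close>, which lie in \<open>k[u\<^sub>1,\<dots>,u\<^sub>n]\<close>.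
\<close>

section \<open>Algebras and derivations\<close>

context k_algebra
begin

lemma map_zero: "\<iota> 0 = 0"
  using map_add[of 0 0] by simp

lemma map_minus: "\<iota> (- c) = - \<iota> c"
  using map_add[of c "- c"] by (simp add: map_zero eq_neg_iff_add_eq_0 add.commute)

lemma map_of_nat: "\<iota> (of_nat n) = of_nat n"
  by (induction n) (simp_all add: map_zero map_one map_add)

lemma map_of_int: "\<iota> (of_int m) = of_int m"
  by (cases m rule: int_cases2) (simp_all add: map_of_nat map_minus)

end

lemma k_algebra_to_fract:
  fixes \<iota> :: "'k :: field \<Rightarrow> 'b :: idom"
  assumes "k_algebra \<iota>"
  shows "k_algebra (to_fract \<circ> \<iota>)"
proof -
  interpret k_algebra \<iota> by fact
  show ?thesis
    by unfold_locales (simp_all add: map_one map_add map_mult)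
qed

text \<open>\<open>hull\<close> is an intersection of subalgebras, and any intersection of
  subalgebras is again one.\<close>

lemma subalgebra_k_adjoin: "subalgebra \<iota> (k_adjoin \<iota> S)"
  unfolding k_adjoin_def by (rule hull_in) (force simp: subalgebra_def)

lemma k_adjoin_superset: "S \<subseteq> k_adjoin \<iota> S"
  unfolding k_adjoin_def by (rule hull_subset)

lemma k_adjoin_minimal: "S \<subseteq> T \<Longrightarrow> subalgebra \<iota> T \<Longrightarrow> k_adjoin \<iota> S \<subseteq> T"
  unfolding k_adjoin_def by (rule hull_minimal)

lemma subalgebra_add: "subalgebra \<iota> A \<Longrightarrow> x \<in> A \<Longrightarrow> y \<in> A \<Longrightarrow> x + y \<in> A"
  and subalgebra_mult: "subalgebra \<iota> A \<Longrightarrow> x \<in> A \<Longrightarrow> y \<in> A \<Longrightarrow> x * y \<in> A"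
  and subalgebra_scalar: "subalgebra \<iota> A \<Longrightarrow> \<iota> c \<in> A"
  by (auto simp: subalgebra_def)

lemma derivation_on_scalar:
  assumes "k_algebra \<iota>" "derivation_on \<iota> A D" "subalgebra \<iota> A"
  shows "D (\<iota> c) = 0"
proof -
  interpret k_algebra \<iota> by fact
  have one: "1 \<in> A"
    using subalgebra_scalar[OF assms(3), of 1] by (simp add: map_one)
  then have "D (\<iota> c * 1) = \<iota> c * D 1"
    using assms(2) unfolding derivation_on_def by blast
  then show ?thesis
    using derivation_on_one[OF assms(2) one] by simp
qed

text \<open>The Leibniz rule makes products of constants constant. With
  \<open>k_adjoin_minimal\<close>, an adjunction then lies in the kernel as soon as its generators
  do.\<close>

lemma subalgebra_ker_on:
  assumes "k_algebra \<iota>" "derivation_on \<iota> A D" "subalgebra \<iota> A"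
  shows "subalgebra \<iota> (ker_on A D)"
  using assms(2,3) derivation_on_scalar[OF assms]
  by (auto simp: subalgebra_def ker_on_def derivation_on_def)

lemma to_fract_in_localization: "to_fract a \<in> localization s"
  by (force simp: localization_def to_fract_def intro: exI[of _ a] exI[of _ 0])

lemma subalgebra_localization:
  fixes s :: "'b :: idom"
  assumes "s \<noteq> 0"
  shows "subalgebra (to_fract \<circ> \<iota>) (localization s)"
proof -
  have "Fract a (s ^ m) + Fract b (s ^ n) = Fract (a * s ^ n + b * s ^ m) (s ^ (m + n))"
    "Fract a (s ^ m) * Fract b (s ^ n) = Fract (a * b) (s ^ (m + n))" for a b m n
    using assms by (simp_all add: power_add)
  then have "x + y \<in> localization s" "x * y \<in> localization s"
    if "x \<in> localization s" "y \<in> localization s" for x y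
    using that unfolding localization_def by fastforce+
  then show ?thesis
    by (auto simp: subalgebra_def to_fract_in_localization)
qed

text \<open>Each factor \<open>s\<close> contributes weight 1, so multiplying by
  \<open>s ^ n\<close> raises weights by \<open>n\<close>.\<close>

lemma derivation_on_power:
  assumes D: "derivation_on \<iota> UNIV D" and s: "D s = s"
  shows "D (s ^ n) = of_nat n * s ^ n"
proof (induction n)
  case 0
  then show ?case using derivation_on_one[OF D] by simp
next
  case (Suc n)
  have "D (s * s ^ n) = D s * s ^ n + s * D (s ^ n)"
    using D unfolding derivation_on_def by blast
  then show ?case by (simp add: Suc s algebra_simps)
qed

section \<open>Eigenvectors\<close>

lemma eigenspace_mult:
  assumes "k_algebra \<iota>" "derivation_on \<iota> UNIV D"
    and "x \<in> eigenspace \<iota> D c" "y \<in> eigenspace \<iota> D d"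
  shows "x * y \<in> eigenspace \<iota> D (c + d)"
proof -
  interpret k_algebra \<iota> by fact
  have "D (x * y) = D x * y + x * D y"
    using assms(2) unfolding derivation_on_def by blast
  then show ?thesis
    using assms(3,4) by (simp add: eigenspace_def map_add algebra_simps)
qed

text \<open>Multiplying by the power \<open>- m\<close> of \<open>s\<close> cancels the weight
  \<open>m\<close>. The sign of \<open>m\<close> matters because \<open>localization\<close> and the
  quotient rule are phrased with natural exponents.\<close>

lemma normalized_eigenvector_in_ker:
  fixes \<iota> :: "'k :: field \<Rightarrow> 'b :: idom"
  assumes k: "k_algebra \<iota>" and D: "derivation_on \<iota> UNIV D"
    and s: "s \<noteq> 0" "D s = s"
    and y: "y \<in> eigenspace \<iota> D (of_int m)"
  shows "to_fract y * to_fract s powi (- m) \<in> ker_on (localization s) (loc_derivation s D)"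
proof -
  interpret k_algebra \<iota> by fact
  have Dy: "D y = of_int m * y"
    using y by (simp add: eigenspace_def map_of_int)
  have pow: "to_fract (s ^ p) = to_fract s ^ p" for p
    by (induction p) simp_all
  show ?thesis
  proof (cases "m \<ge> 0")
    case True
    then obtain p where p: "m = int p"
      using nonneg_int_cases by blast
    have "to_fract y * to_fract s powi (- m) = to_fract y / to_fract (s ^ p)"
      by (simp add: p power_int_minus divide_inverse pow)
    also have "\<dots> = Fract y (s ^ p)"
      by (simp add: to_fract_def)
    finally have eq: "to_fract y * to_fract s powi (- m) = Fract y (s ^ p)" .
    \<comment> \<open>In the quotient rule both terms of the numerator equal
      \<open>of_nat p * y * s ^ p\<close>.\<close>
    have "loc_derivation s D (Fract y (s ^ p)) = 0"
      using s unfolding loc_derivation_Fract[OF D s(1)]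
      by (simp add: derivation_on_power[OF D s(2)] Dy p Zero_fract_def eq_fract)
    then show ?thesis
      by (auto simp: eq ker_on_def localization_def)
  next
    case False
    \<comment> \<open>For negative weight no denominator occurs: the normalized element is the image
      of \<open>y * s ^ p\<close>, on which \<open>D\<close> itself vanishes.\<close>
    then obtain p where p: "m = - int p"
      by (metis int_cases2 linear neg_0_le_iff_le of_nat_0_le_iff)
    have eq: "to_fract y * to_fract s powi (- m) = to_fract (y * s ^ p)"
      by (simp add: p pow)
    have "D (y * s ^ p) = D y * s ^ p + y * D (s ^ p)"
      using D unfolding derivation_on_def by blast
    then have "D (y * s ^ p) = 0"
      by (simp add: Dy p derivation_on_power[OF D s(2)])
    \<comment> \<open>Removing \<open>to_fract_mult\<close> keeps the product inside one
      \<open>to_fract\<close>, the form to which \<open>loc_derivation_to_fract\<close>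
      applies.\<close>
    then show ?thesis
      by (simp add: eq ker_on_def to_fract_in_localization loc_derivation_to_fract[OF D s(1)]
            del: to_fract_mult)
  qed
qed

text \<open>This is the predicate under the unique existence quantifier in
  \<open>semisimple\<close>, named so that explicit decompositions can be built and then
  compared.\<close>

definition eigen_decomposition ::
    "('k :: field \<Rightarrow> 'b :: comm_ring_1) \<Rightarrow> ('b \<Rightarrow> 'b) \<Rightarrow> ('k \<Rightarrow> 'b) \<Rightarrow> 'b \<Rightarrow> bool" where
  "eigen_decomposition \<iota> D c x \<longleftrightarrow>
     (\<forall>l. c l \<in> eigenspace \<iota> D l) \<and> finite {l. c l \<noteq> 0} \<and> x = (\<Sum>l | c l \<noteq> 0. c l)"

lemma eigen_decomposition_unique:
  "semisimple \<iota> D \<Longrightarrow> eigen_decomposition \<iota> D c x \<Longrightarrow> eigen_decomposition \<iota> D d x \<Longrightarrow> c = d"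
  unfolding semisimple_def eigen_decomposition_def by blast

text \<open>Components may cancel, so the support of the sum can be smaller than the union of the
  two supports; all three sums are therefore extended to that union.\<close>

lemma eigen_decomposition_add:
  assumes D: "derivation_on \<iota> UNIV D"
    and c: "eigen_decomposition \<iota> D c x" and d: "eigen_decomposition \<iota> D d y"
  shows "eigen_decomposition \<iota> D (\<lambda>l. c l + d l) (x + y)"
proof -
  let ?S = "{l. c l \<noteq> 0} \<union> {l. d l \<noteq> 0}"
  have fin: "finite ?S"
    using c d by (simp add: eigen_decomposition_def)
  have sub: "{l. c l + d l \<noteq> 0} \<subseteq> ?S"
    by auto
  have "x = sum c ?S" "y = sum d ?S"
    using c d fin unfolding eigen_decomposition_def
    by (auto intro!: sum.mono_neutral_left)
  moreover have "(\<Sum>l | c l + d l \<noteq> 0. c l + d l) = (\<Sum>l\<in>?S. c l + d l)"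
    using fin sub by (intro sum.mono_neutral_left) auto
  ultimately have "x + y = (\<Sum>l | c l + d l \<noteq> 0. c l + d l)"
    by (simp add: sum.distrib)
  moreover have "D (c l + d l) = D (c l) + D (d l)" for l
    using D unfolding derivation_on_def by blast
  ultimately show ?thesis
    using c d finite_subset[OF sub fin]
    by (simp add: eigen_decomposition_def eigenspace_def algebra_simps)
qed

lemma eigen_decomposition_single:
  assumes D: "derivation_on \<iota> UNIV D" and x: "x \<in> eigenspace \<iota> D m"
  shows "eigen_decomposition \<iota> D (\<lambda>l. if l = m then x else 0) x"
proof -
  have "D (0 + 0) = D 0 + D 0"
    using D unfolding derivation_on_def by blast
  then have "D 0 = 0" by simp
  \<comment> \<open>The support is empty when \<open>x\<close> is zero, hence the case
    distinction.\<close>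
  moreover have "{l. (if l = m then x else 0) \<noteq> 0} = (if x = 0 then {} else {m})"
    by auto
  ultimately show ?thesis
    using x by (simp add: eigen_decomposition_def eigenspace_def)
qed

section \<open>Sums of homogeneous elements\<close>

text \<open>The additive monoid generated by \<open>M\<close>, in inductive form so that a
  decomposition can be built one summand at a time.\<close>

inductive_set sums_of :: "'b :: comm_ring_1 set \<Rightarrow> 'b set" for M where
  zero: "0 \<in> sums_of M"
| add: "y \<in> M \<Longrightarrow> w \<in> sums_of M \<Longrightarrow> y + w \<in> sums_of M"

lemma sums_of_superset: "M \<subseteq> sums_of M"
  using sums_of.add[OF _ sums_of.zero] by force

lemma sums_of_closed_add: "x \<in> sums_of M \<Longrightarrow> y \<in> sums_of M \<Longrightarrow> x + y \<in> sums_of M"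
  by (induction rule: sums_of.induct) (simp_all add: add.assoc sums_of.add)

lemma sums_of_closed_mult:
  assumes M: "\<And>x y. x \<in> M \<Longrightarrow> y \<in> M \<Longrightarrow> x * y \<in> M"
    and x: "x \<in> sums_of M" and y: "y \<in> sums_of M"
  shows "x * y \<in> sums_of M"
proof -
  \<comment> \<open>Distributivity is applied to one factor at a time: first the sum
    \<open>y\<close> is expanded against a single element of \<open>M\<close>, then the sum
    \<open>x\<close>.\<close>
  have single: "z * y \<in> sums_of M" if "z \<in> M" for z
    using y
    by (induction rule: sums_of.induct)
       (simp_all add: distrib_left sums_of.zero sums_of.add M that)
  show ?thesis
    using x
    by (induction rule: sums_of.induct)
       (simp_all add: distrib_right sums_of.zero sums_of_closed_add single)
qed

text \<open>A product of sums expands into a sum of products, so the sums over a multiplicatively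
  closed \<open>M\<close> containing the scalars already form a subalgebra.\<close>

lemma k_adjoin_subset_sums_of:
  assumes "S \<subseteq> M" "range \<iota> \<subseteq> M" "\<And>x y. x \<in> M \<Longrightarrow> y \<in> M \<Longrightarrow> x * y \<in> M"
  shows "k_adjoin \<iota> S \<subseteq> sums_of M"
proof (rule k_adjoin_minimal)
  show "S \<subseteq> sums_of M"
    using assms(1) sums_of_superset by blast
  show "subalgebra \<iota> (sums_of M)"
    using assms(2) sums_of_superset[of M] sums_of_closed_add sums_of_closed_mult[OF assms(3)]
    unfolding subalgebra_def by blast
qed

text \<open>The homogeneous elements whose weight-zero normalization lands in \<open>A\<close>. The
  weight is existentially quantified since zero has every weight.\<close>

definition normalized_in ::
    "('k :: field \<Rightarrow> 'b :: idom) \<Rightarrow> ('b \<Rightarrow> 'b) \<Rightarrow> 'b \<Rightarrow> 'b fract set \<Rightarrow> 'b set" where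
  "normalized_in \<iota> D s A =
     {y. \<exists>m::int. y \<in> eigenspace \<iota> D (of_int m) \<and> to_fract y * to_fract s powi (- m) \<in> A}"

text \<open>Weights add under multiplication, so the normalization of a product is the product of
  the normalizations.\<close>

lemma normalized_in_mult:
  fixes \<iota> :: "'k :: field \<Rightarrow> 'b :: idom"
  assumes k: "k_algebra \<iota>" and D: "derivation_on \<iota> UNIV D" and s: "s \<noteq> 0"
    and A: "subalgebra (to_fract \<circ> \<iota>) A"
    and xy: "x \<in> normalized_in \<iota> D s A" "y \<in> normalized_in \<iota> D s A"
  shows "x * y \<in> normalized_in \<iota> D s A"
proof -
  let ?t = "to_fract s"
  obtain p q :: int where x: "x \<in> eigenspace \<iota> D (of_int p)" "to_fract x * ?t powi (- p) \<in> A"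
    and y: "y \<in> eigenspace \<iota> D (of_int q)" "to_fract y * ?t powi (- q) \<in> A"
    using xy unfolding normalized_in_def by blast
  have "?t powi (- p + - q) = ?t powi (- p) * ?t powi (- q)"
    using s by (intro power_int_add) simp
  then have "to_fract (x * y) * ?t powi (- (p + q))
      = (to_fract x * ?t powi (- p)) * (to_fract y * ?t powi (- q))"
    by simp
  moreover have "x * y \<in> eigenspace \<iota> D (of_int (p + q))"
    using eigenspace_mult[OF k D x(1) y(1)] by simp
  ultimately show ?thesis
    unfolding normalized_in_def mem_Collect_eq using subalgebra_mult[OF A x(2) y(2)] by metis
qed

text \<open>Only summands of weight 0 contribute to \<open>c 0\<close>, and such a summand is its
  own normalization, hence in \<open>A\<close>. The decomposition grows along the sum.\<close>

lemma sums_of_normalized_in_weight_zero: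
  fixes \<iota> :: "'k :: field_char_0 \<Rightarrow> 'b :: idom"
  assumes k: "k_algebra \<iota>" and D: "derivation_on \<iota> UNIV D"
    and A: "subalgebra (to_fract \<circ> \<iota>) A"
    and x: "x \<in> sums_of (normalized_in \<iota> D s A)"
  shows "\<exists>c. eigen_decomposition \<iota> D c x \<and> to_fract (c 0) \<in> A"
proof -
  interpret k_algebra \<iota> by fact
  have zero_A: "0 \<in> A"
    using subalgebra_scalar[OF A, of 0] by (simp add: map_zero)
  show ?thesis
    using x
  proof induction
    case zero
    have "(0 :: 'b) \<in> eigenspace \<iota> D 0"
      using derivation_on_scalar[OF k D, of 0] by (simp add: eigenspace_def map_zero subalgebra_def)
    from eigen_decomposition_single[OF D this] show ?case
      using zero_A by force
  next
    case (add y w)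
    then obtain c m where c: "eigen_decomposition \<iota> D c w" "to_fract (c 0) \<in> A"
      and y: "y \<in> eigenspace \<iota> D (of_int m)" "to_fract y * to_fract s powi (- m) \<in> A"
      unfolding normalized_in_def by blast
    define d where "d l = (if l = of_int m then y else 0)" for l :: 'k
    have "eigen_decomposition \<iota> D (\<lambda>l. d l + c l) (y + w)"
      using eigen_decomposition_single[OF D y(1)] unfolding d_def
      by (rule eigen_decomposition_add[OF D _ c(1)])
    \<comment> \<open>For \<open>m = 0\<close> the power of \<open>s\<close> is 1. Otherwise
      \<open>of_int m\<close> is nonzero in characteristic zero, so \<open>d 0 = 0\<close>.\<close>
    moreover have "to_fract (d 0) \<in> A"
      using y(2) zero_A by (cases "m = 0") (auto simp: d_def)
    then have "to_fract (d 0 + c 0) \<in> A"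
      using subalgebra_add[OF A _ c(2)] by simp
    ultimately show ?case by blast
  qed
qed

theorem corollary4p4:
  fixes \<iota> :: "'k :: {alg_closed_field, field_char_0} \<Rightarrow> 'b :: idom"
    and D :: "'b \<Rightarrow> 'b"
    and s :: 'b
    and n :: nat
    and b :: "nat \<Rightarrow> 'b"
    and l :: "nat \<Rightarrow> int"
  assumes "k_algebra \<iota>"
    and "derivation_on \<iota> UNIV D"
    and "semisimple \<iota> D"
    and "\<And>\<mu>. eigenvalue \<iota> D \<mu> \<Longrightarrow> \<mu> \<in> \<int>"
    and "s \<noteq> 0"
    and "D s = s"
    and "k_adjoin \<iota> (b ` {1..n}) = UNIV"
    and "\<And>i. i \<in> {1..n} \<Longrightarrow> D (b i) = \<iota> (of_int (l i)) * b i"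
  shows "to_fract ` ker_on UNIV D =
           ker_on (localization s) (loc_derivation s D) \<inter> range to_fract \<and>
         ker_on (localization s) (loc_derivation s D) \<inter> range to_fract =
           k_adjoin (to_fract \<circ> \<iota>) ((\<lambda>i. to_fract (b i) * to_fract s powi (- l i)) ` {1..n})
             \<inter> range to_fract"
proof -
  note k = assms(1) and D = assms(2) and s = assms(5)
  interpret k_algebra \<iota> by fact
  define u where "u i = to_fract (b i) * to_fract s powi (- l i)" for i
  define A where "A = k_adjoin (to_fract \<circ> \<iota>) (u ` {1..n})"
  define K where "K = ker_on (localization s) (loc_derivation s D)"
  have A: "subalgebra (to_fract \<circ> \<iota>) A"
    unfolding A_def by (rule subalgebra_k_adjoin)
  have b: "b i \<in> eigenspace \<iota> D (of_int (l i))" if "i \<in> {1..n}" for i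
    using assms(8)[OF that] by (simp add: eigenspace_def)
  \<comment> \<open>The extended derivation restricts to \<open>D\<close> on the copy of
    \<open>B\<close>, which gives the first equality.\<close>
  have ker_D: "to_fract ` ker_on UNIV D = K \<inter> range to_fract"
    by (auto simp: K_def ker_on_def to_fract_in_localization loc_derivation_to_fract[OF D s])
  have "u ` {1..n} \<subseteq> K"
    using normalized_eigenvector_in_ker[OF k D s assms(6) b] by (auto simp: u_def K_def)
  moreover have "subalgebra (to_fract \<circ> \<iota>) K"
    unfolding K_def using s
    by (intro subalgebra_ker_on k_algebra_to_fract k derivation_on_loc_derivation D
          subalgebra_localization)
  ultimately have A_K: "A \<subseteq> K"
    unfolding A_def by (rule k_adjoin_minimal)
  \<comment> \<open>The generators normalize to the \<open>u i\<close>, and scalars have weight 0.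
    Closure under products then makes every element of \<open>B\<close> a sum of elements
    normalizing into \<open>A\<close>.\<close>
  have "k_adjoin \<iota> (b ` {1..n}) \<subseteq> sums_of (normalized_in \<iota> D s A)"
  proof (rule k_adjoin_subset_sums_of)
    have "to_fract (b i) * to_fract s powi (- l i) \<in> A" if "i \<in> {1..n}" for i
      using that k_adjoin_superset[of "u ` {1..n}"] by (force simp: A_def u_def)
    with b show "b ` {1..n} \<subseteq> normalized_in \<iota> D s A"
      unfolding normalized_in_def image_subset_iff mem_Collect_eq by metis
    have "\<iota> c \<in> eigenspace \<iota> D (of_int 0)" for c
      using derivation_on_scalar[OF k D] by (simp add: eigenspace_def map_zero subalgebra_def)
    moreover have "to_fract (\<iota> c) * to_fract s powi (- 0) \<in> A" for c
      using subalgebra_scalar[OF A, of c] by simp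
    ultimately show "range \<iota> \<subseteq> normalized_in \<iota> D s A"
      unfolding normalized_in_def image_subset_iff mem_Collect_eq by metis
  qed (rule normalized_in_mult[OF k D s A])
  then have sums: "x \<in> sums_of (normalized_in \<iota> D s A)" for x
    using assms(7) by blast
  have "to_fract x \<in> A" if "x \<in> ker_on UNIV D" for x
  proof -
    obtain c where c: "eigen_decomposition \<iota> D c x" "to_fract (c 0) \<in> A"
      using sums_of_normalized_in_weight_zero[OF k D A sums] by blast
    have "x \<in> eigenspace \<iota> D 0"
      using that by (simp add: ker_on_def eigenspace_def map_zero)
    \<comment> \<open>The constant \<open>x\<close> also has the decomposition concentrated in
      weight 0; uniqueness forces \<open>c\<close> to be that one.\<close>
    from eigen_decomposition_unique[OF assms(3) c(1) eigen_decomposition_single[OF D this]]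
    have "c 0 = x" by simp
    with c(2) show ?thesis by simp
  qed
  then have "to_fract ` ker_on UNIV D \<subseteq> A"
    by (rule image_subsetI)
  \<comment> \<open>One inclusion holds because \<open>K\<close> meets the copy of \<open>B\<close>
    in the image of the kernel of \<open>D\<close>, which lies in \<open>A\<close>; the other is
    \<open>A_K\<close>.\<close>
  with ker_D A_K have "K \<inter> range to_fract = A \<inter> range to_fract"
    by (intro equalityI Int_greatest Int_mono) simp_all
  with ker_D show ?thesis
    unfolding A_def K_def u_def by simp
qed

end
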